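(* Let $f:\mathcal H\to\mathcal H$ be sufficiently differentiable and satisfy $\mathrm{Re}\,\langle v-w,f(v)-f(w)\rangle_{\mathcal H}\le\ell\,\|v-w\|_{\mathcal H}^2$ for all $v,w\in\mathcal H$. Let $y$ solve $\dot y=f(y)$, $y(0)=y_0$, on $[0,\bar t]$, and let $u_n=\Phi(\theta_n)$ be the results of the regularized Euler method with stepsize $h>0$, regularization parameters $\varepsilon_n>0$ and initial value $y_0=u_0=\Phi(\theta_0)$. Let $c>0$ and assume the stepsize restriction $$h\,\delta_n\le c\,\varepsilon_n^2,\qquad 0\le n\le N.$$ Then, for $t_n=nh\le t_N\le\bar t$, $$\|u_n-y(t_n)\|_{\mathcal H}=O(\delta+h)\quad\text{with }\ \delta=\max_n\delta_n,$$ or more precisely $$\|u_n-y(t_n)\|_{\mathcal H}\le h\sum_{j=0}^{n-1}e^{\ell(t_{n-1}-t_j)}\,\bigl(c_1\delta_j+c_2h\bigr),$$ where $c_1=1+\tfrac12c\beta$ with $\beta$ a bound of the second derivative of $\Phi$ in a neighbourhood of the solution, and $c_2$ is a bound of $\|f'(v)f(v)\|_{\mathcal H}$ for $v$ in a neighbourhood of the solution $y(t)$, i.e. a bound of second derivatives of solutions $\widetilde y$ of $\dot{\widetilde y}=f(\widetilde y)$ with initial values in a neighbourhood of the trajectory $\{y(t):0\le t\le\bar t\}$.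
   Context: $\mathcal H$ is a (real or complex) Hilbert space, $\mathcal Q$ a finite-dimensional inner product space, $\Phi:\mathcal Q\to\mathcal H$ twice continuously differentiable with bounded second derivatives (no regularity, such as injectivity or full rank of $\Phi'$, is assumed). Regularized (explicit) Euler method: from $\theta_n$ at time $t_n=nh$, with $u_n=\Phi(\theta_n)$, let $\dot\theta_n\in\mathcal Q$ be the unique minimizer such that $$\delta_n^2:=\|\Phi'(\theta_n)\dot\theta_n-f(u_n)\|_{\mathcal H}^2+\varepsilon_n^2\|\dot\theta_n\|_{\mathcal Q}^2\quad\text{is minimal},$$ and set $\theta_{n+1}=\theta_n+h\dot\theta_n$, $u_{n+1}=\Phi(\theta_{n+1})$. The neighbourhoods are understood to be large enough to contain the relevant points: the bound $\beta$ holds on the segments between consecutive parameters $\theta_j,\theta_{j+1}$, and the bound $c_2$ holds along the exact solutions $\widetilde y$ of $\dot{\widetilde y}=f(\widetilde y)$ starting at time $t_j$ from $u_j$, on $[t_j,t_{j+1}]$. The constant in the $O$-notation is independent of $h$, $\delta_n$, $\varepsilon_n$, $n$ (with $t_n\le\bar t$). *)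

theory Defs
  imports "HOL-Analysis.Analysis"
begin

text \<open>
  A Hilbert space, real or complex, is a type of class \<^class>\<open>real_inner\<close> and
  \<^class>\<open>complete_space\<close>; a complex one carries in addition a complex scalar multiplication and a
  complex inner product inducing the same norm (antilinear in the first argument). Its
  \<^class>\<open>real_inner\<close> structure is then the real part of the complex inner product. All derivatives are
  Frechet derivatives over the reals, which includes complex differentiable maps.
\<close>

definition complex_inner_product ::
  "(complex \<Rightarrow> 'a \<Rightarrow> 'a) \<Rightarrow> ('a::real_inner \<Rightarrow> 'a \<Rightarrow> complex) \<Rightarrow> bool" where
  "complex_inner_product sc ip \<longleftrightarrow>
     vector_space sc \<and>
     (\<forall>r x. sc (of_real r) x = r *\<^sub>R x) \<and>
     (\<forall>x y z. ip x (y + z) = ip x y + ip x z) \<and>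
     (\<forall>a x y. ip x (sc a y) = a * ip x y) \<and>
     (\<forall>x y. ip y x = cnj (ip x y)) \<and>
     (\<forall>x. ip x x = of_real ((norm x)\<^sup>2))"

definition hilbert_inner_product :: "('a::real_inner \<Rightarrow> 'a \<Rightarrow> complex) \<Rightarrow> bool" where
  "hilbert_inner_product ip \<longleftrightarrow>
     ip = (\<lambda>x y. of_real (inner x y)) \<or> (\<exists>sc. complex_inner_product sc ip)"

text \<open>Unlike \<^class>\<open>euclidean_space\<close>, this admits the zero space.\<close>

definition finite_dimensional :: "'a::real_vector itself \<Rightarrow> bool" where
  "finite_dimensional _ \<longleftrightarrow> (\<exists>B::'a set. finite B \<and> span B = UNIV)"

definition C1_map ::
  "('a::real_normed_vector \<Rightarrow> 'b::real_normed_vector) \<Rightarrow> ('a \<Rightarrow> 'a \<Rightarrow>\<^sub>L 'b) \<Rightarrow> bool" where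
  "C1_map g g' \<longleftrightarrow>
     (\<forall>x. (g has_derivative blinfun_apply (g' x)) (at x)) \<and> continuous_on UNIV g'"

definition ode_solution_on :: "('a::real_normed_vector \<Rightarrow> 'a) \<Rightarrow> real set \<Rightarrow> (real \<Rightarrow> 'a) \<Rightarrow> bool" where
  "ode_solution_on f I z \<longleftrightarrow> (\<forall>t\<in>I. (z has_vector_derivative f (z t)) (at t within I))"

text \<open>In the following, \<open>D\<close> is the derivative of \<open>\<Phi>\<close>.\<close>

definition reg_objective ::
  "('h::real_normed_vector \<Rightarrow> 'h) \<Rightarrow> ('q::real_normed_vector \<Rightarrow> 'h) \<Rightarrow> ('q \<Rightarrow> 'q \<Rightarrow>\<^sub>L 'h) \<Rightarrow>
   real \<Rightarrow> 'q \<Rightarrow> 'q \<Rightarrow> real" where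
  "reg_objective f \<Phi> D \<epsilon> \<theta> v =
     (norm (blinfun_apply (D \<theta>) v - f (\<Phi> \<theta>)))\<^sup>2 + \<epsilon>\<^sup>2 * (norm v)\<^sup>2"

definition defect ::
  "('h::real_normed_vector \<Rightarrow> 'h) \<Rightarrow> ('q::real_normed_vector \<Rightarrow> 'h) \<Rightarrow> ('q \<Rightarrow> 'q \<Rightarrow>\<^sub>L 'h) \<Rightarrow>
   (nat \<Rightarrow> real) \<Rightarrow> (nat \<Rightarrow> 'q) \<Rightarrow> (nat \<Rightarrow> 'q) \<Rightarrow> nat \<Rightarrow> real" where
  "defect f \<Phi> D \<epsilon> \<theta> d\<theta> n = sqrt (reg_objective f \<Phi> D (\<epsilon> n) (\<theta> n) (d\<theta> n))"

text \<open>The minimizer is unique when the regularization parameter is nonzero, by strict convexity.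
  The last one, \<open>d\<theta> N\<close>, takes no part in a step and serves only to define the defect at \<open>N\<close>.\<close>

definition regularized_euler ::
  "('h::real_normed_vector \<Rightarrow> 'h) \<Rightarrow> ('q::real_normed_vector \<Rightarrow> 'h) \<Rightarrow> ('q \<Rightarrow> 'q \<Rightarrow>\<^sub>L 'h) \<Rightarrow>
   real \<Rightarrow> nat \<Rightarrow> (nat \<Rightarrow> real) \<Rightarrow> (nat \<Rightarrow> 'q) \<Rightarrow> (nat \<Rightarrow> 'q) \<Rightarrow> bool" where
  "regularized_euler f \<Phi> D h N \<epsilon> \<theta> d\<theta> \<longleftrightarrow>
     (\<forall>n\<le>N. is_arg_min (reg_objective f \<Phi> D (\<epsilon> n) (\<theta> n)) (\<lambda>_. True) (d\<theta> n)) \<and>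
     (\<forall>n<N. \<theta> (Suc n) = \<theta> n + h *\<^sub>R d\<theta> n)"

definition second_derivative_bound_on_steps ::
  "('q::real_normed_vector \<Rightarrow> 'q \<Rightarrow>\<^sub>L 'q \<Rightarrow>\<^sub>L 'h::real_normed_vector) \<Rightarrow> nat \<Rightarrow> (nat \<Rightarrow> 'q) \<Rightarrow>
   real \<Rightarrow> bool" where
  "second_derivative_bound_on_steps D2 N \<theta> \<beta> \<longleftrightarrow>
     (\<forall>j<N. \<forall>q\<in>closed_segment (\<theta> j) (\<theta> (Suc j)). norm (D2 q) \<le> \<beta>)"

text \<open>The exact solutions started at the numerical values \<open>u j\<close> exist and are unique for \<open>f\<close>
  continuously differentiable and one-sided Lipschitz; the hypothesis itself does not assert existence.\<close>

definition local_solution_bound ::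
  "('h::real_normed_vector \<Rightarrow> 'h) \<Rightarrow> ('h \<Rightarrow> 'h \<Rightarrow>\<^sub>L 'h) \<Rightarrow> real \<Rightarrow> nat \<Rightarrow> (nat \<Rightarrow> 'h) \<Rightarrow>
   real \<Rightarrow> bool" where
  "local_solution_bound f f' h N u c\<^sub>2 \<longleftrightarrow>
     (\<forall>j<N. \<forall>z. ode_solution_on f {real j * h .. real (Suc j) * h} z \<and> z (real j * h) = u j \<longrightarrow>
        (\<forall>t\<in>{real j * h .. real (Suc j) * h}. norm (blinfun_apply (f' (z t)) (f (z t))) \<le> c\<^sub>2))"

end

theory Submission
  imports Defs
begin

text \<open>
  The error is propagated by the exact flow (Lady Windermere's fan): the one-sided Lipschitz condition
  makes two exact solutions separate at most by the factor \<open>exp (l * h)\<close> over a step, so it suffices to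
  bound the error of one step against the exact solution restarted at the numerical value. That local
  error consists of the residual of the minimization (at most \<open>h * \<delta>\<close>), the curvature term
  \<open>\<beta> / 2 * h\<^sup>2 * (norm d\<theta>)\<^sup>2\<close>, and the Euler error \<open>c\<^sub>2 * h\<^sup>2\<close>. Since \<open>\<epsilon> * norm d\<theta> \<le> \<delta>\<close>, the step size
  restriction gives \<open>h * (norm d\<theta>)\<^sup>2 \<le> c * \<delta>\<close>, which turns the curvature term into a multiple of \<open>h * \<delta>\<close>.

  The restarted solutions have to be constructed. Picard iteration gives them locally; the
  one-sided Lipschitz condition bounds \<open>f\<close> along a solution, so its end points stay Cauchy and it
  continues over the whole step.
\<close>

subsection \<open>Existence of solutions\<close>

text \<open>Isabelle does not infer the class \<^class>\<open>banach\<close> from the sort of the Hilbert space, although the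
  axioms agree, and the integration library needs it. The type below is an isometric copy of the
  space with the missing instance; local existence is proved there and carried back.\<close>

typedef 'a banach_copy = "UNIV :: 'a set" ..

setup_lifting type_definition_banach_copy

instantiation banach_copy :: ("{real_normed_vector, complete_space}") real_normed_vector
begin

lift_definition zero_banach_copy :: "'a banach_copy" is 0 .
lift_definition plus_banach_copy :: "'a banach_copy \<Rightarrow> 'a banach_copy \<Rightarrow> 'a banach_copy" is "(+)" .
lift_definition minus_banach_copy :: "'a banach_copy \<Rightarrow> 'a banach_copy \<Rightarrow> 'a banach_copy" is "(-)" .
lift_definition uminus_banach_copy :: "'a banach_copy \<Rightarrow> 'a banach_copy" is uminus .
lift_definition scaleR_banach_copy :: "real \<Rightarrow> 'a banach_copy \<Rightarrow> 'a banach_copy" is scaleR .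
lift_definition norm_banach_copy :: "'a banach_copy \<Rightarrow> real" is norm .
lift_definition dist_banach_copy :: "'a banach_copy \<Rightarrow> 'a banach_copy \<Rightarrow> real" is dist .
lift_definition sgn_banach_copy :: "'a banach_copy \<Rightarrow> 'a banach_copy" is sgn .

definition uniformity_banach_copy :: "('a banach_copy \<times> 'a banach_copy) filter" where
  "uniformity_banach_copy = (INF e\<in>{0 <..}. principal {(x, y). dist x y < e})"

definition open_banach_copy :: "'a banach_copy set \<Rightarrow> bool" where
  "open_banach_copy S = (\<forall>x\<in>S. \<forall>\<^sub>F (x', y) in uniformity. x' = x \<longrightarrow> y \<in> S)"

instance
proof
  fix x y :: "'a banach_copy" and a b :: real
  show "dist x y = norm (x - y)" by transfer (rule dist_norm)
  show "sgn x = scaleR (inverse (norm x)) x" by transfer (rule sgn_div_norm)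
  show "(norm x = 0) = (x = 0)" by transfer simp
  show "norm (x + y) \<le> norm x + norm y" by transfer (rule norm_triangle_ineq)
  show "norm (scaleR a x) = \<bar>a\<bar> * norm x" by transfer simp
qed (rule uniformity_banach_copy_def open_banach_copy_def | (transfer, simp add: algebra_simps; fail))+

end

instance banach_copy :: ("{real_normed_vector, complete_space}") banach
proof
  fix X :: "nat \<Rightarrow> 'a banach_copy"
  assume "Cauchy X"
  then have "Cauchy (\<lambda>n. Rep_banach_copy (X n))"
    by (simp add: Cauchy_def dist_banach_copy.rep_eq)
  then obtain l where "(\<lambda>n. Rep_banach_copy (X n)) \<longlonglongrightarrow> l"
    using Cauchy_convergent convergent_def by blast
  then have "X \<longlonglongrightarrow> Abs_banach_copy l"
    by (simp add: lim_sequentially dist_banach_copy.rep_eq Abs_banach_copy_inverse)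
  then show "convergent X" by (rule convergentI)
qed

lemma bounded_linear_Rep_banach_copy:
  "bounded_linear (Rep_banach_copy :: 'a::{real_normed_vector, complete_space} banach_copy \<Rightarrow> 'a)"
  by (rule bounded_linear_intro[where K=1])
     (simp_all add: plus_banach_copy.rep_eq scaleR_banach_copy.rep_eq norm_banach_copy.rep_eq)

section \<open>Local existence by Picard iteration\<close>

text \<open>Banach's fixed point theorem for the integral operator
  \<open>x \<mapsto> v + \<integral> f (x s)\<close>: the condition
  \<open>\<tau> * M \<le> r\<close> keeps the iterates in the ball where \<open>f\<close> is
  Lipschitz, and \<open>\<tau> * L < 1\<close> makes the operator a contraction in the supremum
  norm.\<close>

lemma picard_banach:
  fixes f :: "'a::banach \<Rightarrow> 'a"
  assumes lip: "L-lipschitz_on (cball v r) f"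
    and M: "\<And>x. x \<in> cball v r \<Longrightarrow> norm (f x) \<le> M"
    and "0 \<le> r" "0 \<le> \<tau>" "\<tau> * M \<le> r" "\<tau> * L < 1"
  shows "\<exists>z. z 0 = v \<and> ode_solution_on f {0..\<tau>} z"
proof -
  define S :: "(real \<Rightarrow>\<^sub>C 'a) set" where "S = PiC UNIV (\<lambda>_. cball v r)"
  have memS: "x \<in> S \<longleftrightarrow> (\<forall>t. x t \<in> cball v r)" for x :: "real \<Rightarrow>\<^sub>C 'a"
    by (auto simp: S_def mem_PiC_iff)
  have "complete S"
    by (simp add: S_def closed_PiC complete_eq_closed)
  have "S \<noteq> {}"
  proof -
    have "const_bcontfun v \<in> S"
      using \<open>0 \<le> r\<close> by (simp add: memS const_bcontfun.rep_eq)
    then show ?thesis by auto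
  qed
  \<comment> \<open>Bounded continuous functions live on the whole real line here. Clamping time to
    \<open>{0..\<tau>}\<close> extends the integral operator constantly outside the interval, so its
    values stay bounded and the supremum norm sees only \<open>{0..\<tau>}\<close>.\<close>
  define k where "k = (\<lambda>t. max 0 (min \<tau> t))"
  have k: "k t \<in> {0..\<tau>}" for t
    using \<open>0 \<le> \<tau>\<close> by (auto simp: k_def)
  have contf: "continuous_on (cball v r) f"
    using lip by (rule lipschitz_on_continuous_on)
  have cont: "continuous_on T (\<lambda>s. f (x s))" if "x \<in> S" for x T
    by (rule continuous_on_compose2[OF contf]) (use that in \<open>auto simp: memS\<close>)
  define G where "G = (\<lambda>(x :: real \<Rightarrow>\<^sub>C 'a) t. v + integral {0..k t} (\<lambda>s. f (x s)))"
  have G_cball: "G x t \<in> cball v r" if "x \<in> S" for x t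
  proof -
    have "norm (integral {0..k t} (\<lambda>s. f (x s))) \<le> M * (k t - 0)"
      using k[of t] that by (intro integral_bound cont M) (auto simp: memS)
    also have "\<dots> \<le> M * \<tau>"
      using k[of t] order_trans[OF norm_ge_zero M[of v]] \<open>0 \<le> r\<close> by (intro mult_left_mono) auto
    finally show ?thesis
      using \<open>\<tau> * M \<le> r\<close> by (simp add: G_def dist_norm mult.commute)
  qed
  have G_bcontfun: "G x \<in> bcontfun" if "x \<in> S" for x
  proof -
    have "continuous_on UNIV (\<lambda>t. integral {0..k t} (\<lambda>s. f (x s)))"
      by (rule continuous_on_compose2[OF indefinite_integral_continuous_1[OF integrable_continuous_real[OF cont[OF that]]]])
         (use k in \<open>auto simp: k_def intro!: continuous_intros\<close>)
    then have "continuous_on UNIV (G x)"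
      unfolding G_def by (intro continuous_intros)
    moreover have "bounded (range (G x))"
      by (rule bounded_subset[OF bounded_cball]) (use G_cball[OF that] in blast)
    ultimately show ?thesis by (simp add: bcontfun_def)
  qed
  have "\<exists>!x\<in>S. Bcontfun (G x) = x"
  proof (rule Banach_fix[where c = "\<tau> * L"])
    show "0 \<le> \<tau> * L" using \<open>0 \<le> \<tau>\<close> lipschitz_on_nonneg[OF lip] by simp
    show "(\<lambda>x. Bcontfun (G x)) ` S \<subseteq> S"
      using G_cball by (auto simp: memS Bcontfun_inverse G_bcontfun)
    show "dist (Bcontfun (G x)) (Bcontfun (G y)) \<le> \<tau> * L * dist x y" if "x \<in> S" "y \<in> S" for x y
    proof (rule dist_bound)
      fix t
      have "dist (G x t) (G y t) = norm (integral {0..k t} (\<lambda>s. f (x s) - f (y s)))"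
        by (simp add: G_def dist_norm integral_diff integrable_continuous_real cont that)
      also have "\<dots> \<le> L * dist x y * (k t - 0)"
      proof (rule integral_bound)
        show "norm (f (x s) - f (y s)) \<le> L * dist x y" for s
        proof -
          have "norm (f (x s) - f (y s)) \<le> L * dist (x s) (y s)"
            using lipschitz_onD[OF lip] that by (simp add: memS dist_norm)
          also have "\<dots> \<le> L * dist x y"
            by (intro mult_left_mono dist_bounded lipschitz_on_nonneg[OF lip])
          finally show ?thesis .
        qed
      qed (use k[of t] that in \<open>auto intro!: continuous_intros cont\<close>)
      also have "\<dots> \<le> L * dist x y * \<tau>"
        using k[of t] lipschitz_on_nonneg[OF lip] by (intro mult_left_mono) auto
      finally show "dist (Bcontfun (G x) t) (Bcontfun (G y) t) \<le> \<tau> * L * dist x y"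
        using that by (simp add: Bcontfun_inverse G_bcontfun mult_ac)
    qed
  qed fact+
  then obtain x where x: "x \<in> S" "Bcontfun (G x) = x" by auto
  then have fix_eq: "x t = G x t" for t
    by (metis Bcontfun_inverse G_bcontfun)
  have "x 0 = v"
    using \<open>0 \<le> \<tau>\<close> by (simp add: fix_eq[of 0] G_def k_def)
  moreover have "ode_solution_on f {0..\<tau>} x"
    unfolding ode_solution_on_def
  proof
    fix t assume t: "t \<in> {0..\<tau>}"
    have eq: "x u = v + integral {0..u} (\<lambda>s. f (x s))" if "u \<in> {0..\<tau>}" for u
      using fix_eq[of u] that by (simp add: G_def k_def)
    have "((\<lambda>u. v + integral {0..u} (\<lambda>s. f (x s))) has_vector_derivative f (x t)) (at t within {0..\<tau>})"
      using has_vector_derivative_add[OF has_vector_derivative_const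
          integral_has_vector_derivative[OF cont[OF x(1)] t]] by simp
    then show "(x has_vector_derivative f (x t)) (at t within {0..\<tau>})"
      by (rule has_vector_derivative_transform[OF t eq, rotated])
  qed
  ultimately show ?thesis by blast
qed

lemma picard:
  fixes f :: "'a::{real_normed_vector, complete_space} \<Rightarrow> 'a"
  assumes lip: "L-lipschitz_on (cball v r) f"
    and M: "\<And>x. x \<in> cball v r \<Longrightarrow> norm (f x) \<le> M"
    and "0 \<le> r" "0 \<le> \<tau>" "\<tau> * M \<le> r" "\<tau> * L < 1"
  shows "\<exists>z. z 0 = v \<and> ode_solution_on f {0..\<tau>} z"
proof -
  define g where "g = (\<lambda>x. Abs_banach_copy (f (Rep_banach_copy x)))"
  have Rep_g: "Rep_banach_copy (g x) = f (Rep_banach_copy x)" for x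
    by (simp add: g_def Abs_banach_copy_inverse)
  have "\<exists>z. z 0 = Abs_banach_copy v \<and> ode_solution_on g {0..\<tau>} z"
  proof (rule picard_banach)
    show "L-lipschitz_on (cball (Abs_banach_copy v) r) g"
      using lip by (auto simp: lipschitz_on_def dist_banach_copy.rep_eq Rep_g Abs_banach_copy_inverse)
    show "norm (g x) \<le> M" if "x \<in> cball (Abs_banach_copy v) r" for x
      using M[of "Rep_banach_copy x"] that
      by (simp add: norm_banach_copy.rep_eq dist_banach_copy.rep_eq Rep_g Abs_banach_copy_inverse)
  qed fact+
  then obtain z where z: "z 0 = Abs_banach_copy v" "ode_solution_on g {0..\<tau>} z" by blast
  then have "ode_solution_on f {0..\<tau>} (\<lambda>t. Rep_banach_copy (z t))"
    using bounded_linear.has_vector_derivative[OF bounded_linear_Rep_banach_copy]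
    by (fastforce simp: ode_solution_on_def Rep_g)
  with z(1) show ?thesis
    by (intro exI[of _ "\<lambda>t. Rep_banach_copy (z t)"]) (simp add: Abs_banach_copy_inverse)
qed

section \<open>Restriction, translation and gluing of solutions\<close>

lemma ode_solution_on_subset:
  "ode_solution_on f J z \<Longrightarrow> I \<subseteq> J \<Longrightarrow> ode_solution_on f I z"
  unfolding ode_solution_on_def by (blast intro: has_vector_derivative_within_subset)

lemma ode_solution_on_shift:
  assumes "ode_solution_on f {a..b} z"
  shows "ode_solution_on f {a + s..b + s} (\<lambda>t. z (t - s))"
  unfolding ode_solution_on_def
proof
  fix t assume t: "t \<in> {a + s..b + s}"
  have img: "(\<lambda>t. t - s) ` {a + s..b + s} = {a..b}"
    by (auto simp: image_iff intro: bexI[of _ "_ + s"])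
  have "(z \<circ> (\<lambda>t. t - s) has_vector_derivative 1 *\<^sub>R f (z (t - s))) (at t within {a + s..b + s})"
    using assms t by (intro vector_diff_chain_within)
      (auto simp: img ode_solution_on_def intro!: derivative_eq_intros)
  then show "((\<lambda>t. z (t - s)) has_vector_derivative f (z (t - s))) (at t within {a + s..b + s})"
    by (simp add: o_def)
qed

text \<open>At the joint \<open>b\<close> the two one-sided derivatives are \<open>f (x b)\<close>
  and \<open>f (y b)\<close>, which agree because the values do.\<close>

lemma ode_solution_on_append:
  assumes "ode_solution_on f {a..b} x" "ode_solution_on f {b..c} y" "x b = y b" "a \<le> b" "b \<le> c"
  shows "ode_solution_on f {a..c} (\<lambda>t. if t \<le> b then x t else y t)"
  unfolding ode_solution_on_def
proof
  fix t assume t: "t \<in> {a..c}"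
  have "((\<lambda>t. if t \<in> {a..b} then x t else y t) has_vector_derivative
      (if t \<in> {a..b} then f (x t) else f (y t))) (at t within {a..c})"
  proof (rule has_vector_derivative_If_within_closures)
    show "{a..c} = {a..b} \<union> {b..c}" "t \<in> {a..b} \<union> {b..c}" using assms t by auto
    \<comment> \<open>Both pieces are closed and meet only in \<open>b\<close>, so the closures in
      the gluing rule add nothing to either interval.\<close>
    have eq: "{a..b} \<union> closure {a..b} \<inter> closure {b..c} = {a..b}"
      "{b..c} \<union> closure {a..b} \<inter> closure {b..c} = {b..c}" using assms(4,5) by auto
    show "(x has_vector_derivative f (x t)) (at t within {a..b} \<union> closure {a..b} \<inter> closure {b..c})"
      if "t \<in> {a..b} \<union> closure {a..b} \<inter> closure {b..c}"
      using that assms(1) unfolding eq by (auto simp: ode_solution_on_def)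
    show "(y has_vector_derivative f (y t)) (at t within {b..c} \<union> closure {a..b} \<inter> closure {b..c})"
      if "t \<in> {b..c} \<union> closure {a..b} \<inter> closure {b..c}"
      using that assms(2) unfolding eq by (auto simp: ode_solution_on_def)
    show "x t = y t" "f (x t) = f (y t)" if "t \<in> closure {a..b}" "t \<in> closure {b..c}"
    proof -
      have "t = b" using that by auto
      then show "x t = y t" "f (x t) = f (y t)" using assms(3) by auto
    qed
  qed
  then have "((\<lambda>t. if t \<in> {a..b} then x t else y t) has_vector_derivative
      f (if t \<le> b then x t else y t)) (at t within {a..c})"
    using t by (auto split: if_splits)
  then show "((\<lambda>t. if t \<le> b then x t else y t) has_vector_derivative
      f (if t \<le> b then x t else y t)) (at t within {a..c})"
    by (rule has_vector_derivative_transform[rotated 2]) (use t in auto)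
qed

section \<open>Growth estimates along solutions\<close>

lemma C1_map_has_vector_derivative_compose:
  assumes "C1_map g g'" "(z has_vector_derivative z') (at t within I)"
  shows "((\<lambda>t. g (z t)) has_vector_derivative g' (z t) z') (at t within I)"
proof -
  have "(g has_derivative g' (z t)) (at (z t) within z ` I)"
    using assms(1) by (auto simp: C1_map_def intro: has_derivative_at_withinI)
  from vector_derivative_diff_chain_within[OF assms(2) this] show ?thesis by (simp add: o_def)
qed

text \<open>The function \<open>t \<mapsto> exp (- 2 * l * (t - a)) * (norm (w t))\<^sup>2\<close> is nonincreasing.\<close>

lemma norm_le_exp_of_inner_derivative_le:
  fixes w :: "real \<Rightarrow> 'a::real_inner"
  assumes deriv: "\<And>t. t \<in> {a..b} \<Longrightarrow> (w has_vector_derivative w' t) (at t within {a..b})"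
    and le: "\<And>t. t \<in> {a..b} \<Longrightarrow> inner (w t) (w' t) \<le> l * (norm (w t))\<^sup>2"
    and t: "t \<in> {a..b}"
  shows "norm (w t) \<le> exp (l * (t - a)) * norm (w a)"
proof -
  define \<phi> where "\<phi> = (\<lambda>t. exp (- 2 * l * (t - a)) * inner (w t) (w t))"
  define \<phi>' where "\<phi>' = (\<lambda>t. exp (- 2 * l * (t - a)) * (2 * (inner (w t) (w' t) - l * inner (w t) (w t))))"
  have D: "(\<phi> has_real_derivative \<phi>' s) (at s within {a..b})" if "s \<in> {a..b}" for s
  proof -
    have w2: "((\<lambda>t. inner (w t) (w t)) has_real_derivative 2 * inner (w s) (w' s)) (at s within {a..b})"
      using deriv[OF that] unfolding has_field_derivative_def has_vector_derivative_def
      by (auto intro!: derivative_eq_intros simp: inner_commute)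
    have "((\<lambda>t. exp (- 2 * l * (t - a))) has_real_derivative - 2 * l * exp (- 2 * l * (s - a))) (at s within {a..b})"
      by (auto intro!: derivative_eq_intros)
    from DERIV_mult[OF this w2] show ?thesis
      unfolding \<phi>_def \<phi>'_def by (rule DERIV_cong) (simp add: right_diff_distrib)
  qed
  have "\<phi> t \<le> \<phi> a"
  proof (rule DERIV_nonpos_imp_decreasing_open[where f = \<phi>])
    show "a \<le> t" using t by simp
    show "continuous_on {a..t} \<phi>"
      by (rule continuous_on_subset[OF DERIV_continuous_on[OF D]]) (use t in auto)
    fix s assume s: "a < s" "s < t"
    then have "(\<phi> has_real_derivative \<phi>' s) (at s)"
      using D[of s] t by (simp add: at_within_Icc_at)
    moreover have "\<phi>' s \<le> 0"
      using le[of s] s t by (auto simp: \<phi>'_def power2_norm_eq_inner mult_nonneg_nonpos)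
    ultimately show "\<exists>y. (\<phi> has_real_derivative y) (at s) \<and> y \<le> 0" by blast
  qed
  \<comment> \<open>The weight with exponent \<open>- 2 * l\<close> is the square of the one with
    exponent \<open>- l\<close>, so monotonicity of \<phi> is a comparison of two squares.\<close>
  then have "(exp (- (l * (t - a))) * norm (w t))\<^sup>2 \<le> (norm (w a))\<^sup>2"
    by (simp add: \<phi>_def power_mult_distrib power2_norm_eq_inner mult.assoc flip: exp_double)
  then have "exp (- (l * (t - a))) * norm (w t) \<le> norm (w a)"
    by (rule power2_le_imp_le) simp
  then have "exp (l * (t - a)) * (exp (- (l * (t - a))) * norm (w t)) \<le> exp (l * (t - a)) * norm (w a)"
    by (rule mult_left_mono) simp
  then show ?thesis
    by (simp flip: mult.assoc exp_add)
qed

text \<open>The one-sided Lipschitz condition for the pair \<open>x + s *\<^sub>R v\<close>,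
  \<open>x\<close>, divided by \<open>s\<^sup>2\<close>, becomes this bound as \<open>s\<close>
  tends to 0.\<close>

lemma inner_derivative_le:
  assumes osl: "\<And>v w. inner (v - w) (f v - f w) \<le> l * (norm (v - w))\<^sup>2"
    and C1: "C1_map f f'"
  shows "inner v (f' x v) \<le> l * (norm v)\<^sup>2"
proof -
  have "((\<lambda>s. x + s *\<^sub>R v) has_vector_derivative v) (at 0)"
    by (auto intro!: derivative_eq_intros)
  from C1_map_has_vector_derivative_compose[OF C1 this]
  have "((\<lambda>s. inner v (f (x + s *\<^sub>R v))) has_vector_derivative inner v (f' x v)) (at 0)"
    using bounded_linear.has_vector_derivative[OF bounded_linear_inner_right] by fastforce
  then have "((\<lambda>s. inner v (f (x + s *\<^sub>R v))) has_real_derivative inner v (f' x v)) (at 0)"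
    by (simp add: has_real_derivative_iff_has_vector_derivative)
  then have "(\<lambda>s. (inner v (f (x + s *\<^sub>R v)) - inner v (f x)) / s) \<midarrow>0\<rightarrow> inner v (f' x v)"
    by (simp add: DERIV_def)
  moreover have "(inner v (f (x + s *\<^sub>R v)) - inner v (f x)) / s \<le> l * (norm v)\<^sup>2" if "s \<noteq> 0" for s
  proof -
    \<comment> \<open>Keeping the factor \<open>s\<close> on the left allows division by the
      positive \<open>s\<^sup>2\<close>, so negative \<open>s\<close> is covered too and the
      two-sided limit can be taken.\<close>
    have "s * inner v (f (x + s *\<^sub>R v) - f x) \<le> l * (s\<^sup>2 * (norm v)\<^sup>2)"
      using osl[of "x + s *\<^sub>R v" x] by (simp add: power_mult_distrib)
    then have "(s * inner v (f (x + s *\<^sub>R v) - f x)) / s\<^sup>2 \<le> (l * (s\<^sup>2 * (norm v)\<^sup>2)) / s\<^sup>2"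
      by (rule divide_right_mono) simp
    then show ?thesis
      using that by (simp add: power2_eq_square inner_diff_right)
  qed
  then have "eventually (\<lambda>s. (inner v (f (x + s *\<^sub>R v)) - inner v (f x)) / s \<le> l * (norm v)\<^sup>2) (at 0)"
    by (simp add: eventually_at_filter)
  ultimately show ?thesis
    by (rule tendsto_upperbound) simp
qed

lemma ode_solutions_norm_diff_le:
  fixes f :: "'a::real_inner \<Rightarrow> 'a"
  assumes osl: "\<And>v w. inner (v - w) (f v - f w) \<le> l * (norm (v - w))\<^sup>2"
    and "ode_solution_on f {a..b} x" "ode_solution_on f {a..b} y" "t \<in> {a..b}"
  shows "norm (x t - y t) \<le> exp (l * (t - a)) * norm (x a - y a)"
  using assms
  by (intro norm_le_exp_of_inner_derivative_le[where w' = "\<lambda>t. f (x t) - f (y t)"])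
     (auto simp: ode_solution_on_def intro!: has_vector_derivative_diff)

text \<open>Along a solution, \<open>w = f (z t)\<close> satisfies the linearized equation
  \<open>w' = f' (z t) w\<close>, which inherits the one-sided bound. The result rules out blow-up:
  on a bounded time interval the speed is controlled by the initial value alone.\<close>

lemma ode_solution_speed_le:
  assumes osl: "\<And>v w. inner (v - w) (f v - f w) \<le> l * (norm (v - w))\<^sup>2"
    and C1: "C1_map f f'"
    and z: "ode_solution_on f {a..b} z" "t \<in> {a..b}"
  shows "norm (f (z t)) \<le> exp (l * (t - a)) * norm (f (z a))"
  using z
  by (intro norm_le_exp_of_inner_derivative_le[where w' = "\<lambda>t. f' (z t) (f (z t))"])
     (auto simp: ode_solution_on_def intro: C1_map_has_vector_derivative_compose[OF C1]
        inner_derivative_le[OF osl C1])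

section \<open>Uniform local existence and continuation\<close>

text \<open>Closed balls need not be compact in infinite dimension. Continuity of \<open>f'\<close>
  at the centre alone bounds its norm by \<open>norm (f' u) + 1\<close> on a small ball.\<close>

lemma C1_map_locally_lipschitz:
  assumes "C1_map f f'"
  shows "\<exists>r>0. \<exists>L. L-lipschitz_on (cball u r) f"
proof -
  have "isCont f' u"
    using assms by (simp add: C1_map_def continuous_on_eq_continuous_at)
  then obtain d where d: "d > 0" "\<And>x. dist x u < d \<Longrightarrow> dist (f' x) (f' u) < 1"
    unfolding continuous_at_eps_delta by (metis zero_less_one)
  have "(norm (f' u) + 1)-lipschitz_on (cball u (d / 2)) f"
  proof (rule bounded_derivative_imp_lipschitz)
    show "(f has_derivative f' x) (at x within cball u (d / 2))" for x
      using assms by (auto simp: C1_map_def intro: has_derivative_at_withinI)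
    show "onorm (f' x) \<le> norm (f' u) + 1" if "x \<in> cball u (d / 2)" for x
    proof -
      have "norm (f' x - f' u) < 1"
        using d(2)[of x] that d(1) by (simp add: dist_norm norm_minus_commute)
      then show ?thesis
        using norm_triangle_sub[of "f' x" "f' u"] by (simp add: norm_blinfun.rep_eq)
    qed
  qed auto
  with d(1) show ?thesis by (intro exI[of _ "d / 2"]) auto
qed

text \<open>The point is that one \<tau> serves all initial values near \<open>u\<close>. Halving
  the radius achieves this: a ball of radius \<open>r / 2\<close> about such an initial value stays
  in the ball about \<open>u\<close> where \<open>f\<close> is bounded and Lipschitz.\<close>

lemma C1_map_local_solutions:
  fixes f :: "'a::{real_normed_vector, complete_space} \<Rightarrow> 'a"
  assumes "C1_map f f'"
  shows "\<exists>r>0. \<exists>\<tau>>0. \<forall>v\<in>cball u r. \<exists>z. z 0 = v \<and> ode_solution_on f {0..\<tau>} z"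
proof -
  obtain r L where r: "r > 0" and lip: "L-lipschitz_on (cball u r) f"
    using C1_map_locally_lipschitz[OF assms] by blast
  have L: "L \<ge> 0" using lip by (rule lipschitz_on_nonneg)
  define M where "M = norm (f u) + L * r"
  have M: "norm (f x) \<le> M" if "x \<in> cball u r" for x
  proof -
    have "norm (f x - f u) \<le> L * dist x u"
      using lipschitz_onD[OF lip that, of u] r by (simp add: dist_norm)
    also have "\<dots> \<le> L * r"
      using that L by (intro mult_left_mono) (auto simp: dist_commute)
    finally show ?thesis
      using norm_triangle_sub[of "f x" "f u"] by (simp add: M_def)
  qed
  have "M \<ge> 0" using L r by (simp add: M_def)
  \<comment> \<open>The first term keeps solutions in the half-size ball, the second gives a
    contraction. Adding 1 in the denominators covers \<open>M = 0\<close> and \<open>L = 0\<close>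
    and makes \<open>\<tau> * L < 1\<close> strict.\<close>
  define \<tau> where "\<tau> = min (r / 2 / (M + 1)) (1 / (L + 1))"
  have \<tau>: "\<tau> > 0" using \<open>M \<ge> 0\<close> L r by (simp add: \<tau>_def)
  have "\<tau> \<le> r / 2 / (M + 1)" by (simp add: \<tau>_def)
  then have "\<tau> * (M + 1) \<le> r / 2"
    using \<open>M \<ge> 0\<close> by (subst (asm) pos_le_divide_eq) auto
  then have \<tau>M: "\<tau> * M \<le> r / 2" using \<tau> by (simp add: algebra_simps)
  have "\<tau> \<le> 1 / (L + 1)" by (simp add: \<tau>_def)
  then have "\<tau> * (L + 1) \<le> 1"
    using L by (subst (asm) pos_le_divide_eq) auto
  then have \<tau>L: "\<tau> * L < 1" using \<tau> by (simp add: algebra_simps)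
  have "\<exists>z. z 0 = v \<and> ode_solution_on f {0..\<tau>} z" if "v \<in> cball u (r / 2)" for v
  proof (rule picard)
    have sub: "cball v (r / 2) \<subseteq> cball u r"
    proof
      fix x assume "x \<in> cball v (r / 2)"
      then show "x \<in> cball u r" using that dist_triangle[of u x v] by simp
    qed
    show "L-lipschitz_on (cball v (r / 2)) f"
      using lip sub by (rule lipschitz_on_subset)
    show "norm (f x) \<le> M" if "x \<in> cball v (r / 2)" for x
      using M sub that by blast
  qed (use r \<tau> \<tau>M \<tau>L in auto)
  with r \<tau> show ?thesis
    by (intro exI[of _ "r / 2"] conjI exI[of _ \<tau>]) auto
qed

lemma vector_derivative_bound:
  assumes "convex S" "\<And>t. t \<in> S \<Longrightarrow> (f has_vector_derivative f' t) (at t within S)"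
    and B: "\<And>t. t \<in> S \<Longrightarrow> norm (f' t) \<le> B" and "s \<in> S" "t \<in> S"
  shows "norm (f s - f t) \<le> B * norm (s - t)"
proof (rule differentiable_bound)
  show "onorm (\<lambda>h. h *\<^sub>R f' t) \<le> B" if "t \<in> S" for t
    using B[OF that] by (intro onorm_le) (simp add: mult.commute[of B] mult_left_mono)
qed (use assms in \<open>auto simp: has_vector_derivative_def\<close>)

lemma ode_solution_exists:
  fixes f :: "'a::{real_inner, complete_space} \<Rightarrow> 'a"
  assumes osl: "\<And>v w. inner (v - w) (f v - f w) \<le> l * (norm (v - w))\<^sup>2"
    and C1: "C1_map f f'" and "0 \<le> T"
  shows "\<exists>z. z 0 = v \<and> ode_solution_on f {0..T} z"
proof -
  define sol where "sol = (\<lambda>t z. z 0 = v \<and> ode_solution_on f {0..t} z)"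
  define A where "A = {t \<in> {0..T}. \<exists>z. sol t z}"
  define K where "K = exp (\<bar>l\<bar> * T) * norm (f v)"
  \<comment> \<open>By uniqueness the longer solution passes through the end point of the shorter
    one. From there it moves with speed at most \<open>K\<close>, a bound that does not depend on
    either solution.\<close>
  have close: "norm (y t - x s) \<le> K * (t - s)"
    if "sol s x" "sol t y" "0 \<le> s" "s \<le> t" "t \<le> T" for x y s t
  proof -
    have "ode_solution_on f {0..s} y"
      using that by (auto simp: sol_def intro: ode_solution_on_subset)
    then have "norm (x s - y s) \<le> exp (l * (s - 0)) * norm (x 0 - y 0)"
      using that by (intro ode_solutions_norm_diff_le[OF osl, where b = s]) (auto simp: sol_def)
    then have "x s = y s" using that by (simp add: sol_def)
    moreover have "norm (y t - y s) \<le> K * norm (t - s)"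
    proof (rule vector_derivative_bound)
      show "(y has_vector_derivative f (y \<xi>)) (at \<xi> within {0..t})" if "\<xi> \<in> {0..t}" for \<xi>
        using that \<open>sol t y\<close> by (auto simp: sol_def ode_solution_on_def)
      show "norm (f (y \<xi>)) \<le> K" if "\<xi> \<in> {0..t}" for \<xi>
      proof -
        have "norm (f (y \<xi>)) \<le> exp (l * (\<xi> - 0)) * norm (f (y 0))"
          using that \<open>sol t y\<close> by (intro ode_solution_speed_le[OF osl C1]) (auto simp: sol_def)
        also have "l * (\<xi> - 0) \<le> \<bar>l\<bar> * T"
          using that \<open>t \<le> T\<close> by (intro mult_mono) auto
        finally show ?thesis
          using \<open>sol t y\<close> by (simp add: K_def sol_def mult_right_mono)
      qed
    qed (use that in auto)
    ultimately show ?thesis using that by simp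
  qed
  text \<open>The end points of solutions on \<open>{0..t}\<close>, \<open>t\<close> approaching the supremum of \<open>A\<close>, converge. Near the
    limit the local existence time is uniform, so one of these solutions extends beyond the supremum.\<close>
  obtain r0 \<tau>0 where 0: "r0 > 0" "\<tau>0 > 0" "\<forall>w\<in>cball v r0. \<exists>z. z 0 = w \<and> ode_solution_on f {0..\<tau>0} z"
    using C1_map_local_solutions[OF C1, of v] by blast
  then obtain z0 where "z0 0 = v" "ode_solution_on f {0..\<tau>0} z0" by force
  then have "sol 0 z0"
    using 0 by (auto simp: sol_def intro: ode_solution_on_subset)
  then have "0 \<in> A" using \<open>0 \<le> T\<close> by (auto simp: A_def)
  have bdd: "bdd_above A" by (auto simp: A_def bdd_above_def)
  define \<sigma> where "\<sigma> = Sup A"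
  have "\<sigma> \<in> closure A"
    unfolding \<sigma>_def using \<open>0 \<in> A\<close> bdd by (intro closure_contains_Sup) auto
  then obtain t where t: "\<And>n. t n \<in> A" "t \<longlonglongrightarrow> \<sigma>"
    by (auto simp: closure_sequential)
  have "\<forall>n. \<exists>z. sol (t n) z" using t(1) by (auto simp: A_def)
  then obtain z where z: "\<And>n. sol (t n) (z n)" by metis
  have dist_le: "dist (z m (t m)) (z n (t n)) \<le> K * dist (t m) (t n)" for m n
  proof (cases "t m \<le> t n")
    case True
    then show ?thesis using close[OF z z, of m n] t(1)
      by (simp add: A_def dist_norm norm_minus_commute)
  next
    case False
    then show ?thesis using close[OF z z, of n m] t(1)
      by (simp add: A_def dist_norm)
  qed
  have "Cauchy (\<lambda>n. z n (t n))"
  proof (rule metric_CauchyI)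
    fix e :: real assume "e > 0"
    have "K \<ge> 0" by (simp add: K_def)
    obtain n0 where n0: "\<And>m n. m \<ge> n0 \<Longrightarrow> n \<ge> n0 \<Longrightarrow> dist (t m) (t n) < e / (K + 1)"
      using metric_CauchyD[OF LIMSEQ_imp_Cauchy[OF t(2)], of "e / (K + 1)"] \<open>e > 0\<close> \<open>K \<ge> 0\<close> by auto
    have "dist (z m (t m)) (z n (t n)) < e" if "m \<ge> n0" "n \<ge> n0" for m n
    proof -
      have "dist (z m (t m)) (z n (t n)) \<le> (K + 1) * dist (t m) (t n)"
        using dist_le[of m n] by (simp add: distrib_right add_increasing2)
      also have "\<dots> < e"
        using n0[OF that] \<open>K \<ge> 0\<close> by (simp add: field_simps)
      finally show ?thesis .
    qed
    then show "\<exists>M. \<forall>m\<ge>M. \<forall>n\<ge>M. dist (z m (t m)) (z n (t n)) < e" by blast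
  qed
  then obtain u where u: "(\<lambda>n. z n (t n)) \<longlonglongrightarrow> u"
    using Cauchy_convergent convergent_def by blast
  obtain r \<tau> where r: "r > 0" "\<tau> > 0"
    and ext: "\<And>w. w \<in> cball u r \<Longrightarrow> \<exists>z. z 0 = w \<and> ode_solution_on f {0..\<tau>} z"
    using C1_map_local_solutions[OF C1, of u] by blast
  have "\<forall>\<^sub>F n in sequentially. dist (z n (t n)) u < r \<and> dist (t n) \<sigma> < \<tau>"
    using tendstoD[OF u r(1)] tendstoD[OF t(2) r(2)] by eventually_elim simp
  then obtain n where n: "dist (z n (t n)) u < r" "dist (t n) \<sigma> < \<tau>"
    using eventually_happens'[OF sequentially_bot] by blast
  obtain x where x: "x 0 = z n (t n)" "ode_solution_on f {0..\<tau>} x"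
    using ext[of "z n (t n)"] n(1) by (auto simp: dist_commute)
  define y where "y = (\<lambda>s. if s \<le> t n then z n s else x (s - t n))"
  have tn: "0 \<le> t n" "t n \<le> T" using t(1) by (auto simp: A_def)
  have "ode_solution_on f {t n..t n + \<tau>} (\<lambda>s. x (s - t n))"
    using ode_solution_on_shift[OF x(2), of "t n"] by (simp add: add.commute)
  then have "ode_solution_on f {0..t n + \<tau>} y"
    unfolding y_def using z[of n] x(1) tn r by (intro ode_solution_on_append) (auto simp: sol_def)
  moreover have "y 0 = v"
    using z[of n] tn by (simp add: y_def sol_def)
  ultimately have sol: "sol s y" if "s \<le> t n + \<tau>" for s
    using that by (auto simp: sol_def intro: ode_solution_on_subset)
  have "min T (t n + \<tau>) \<in> A"
    using tn r sol[of "min T (t n + \<tau>)"] by (auto simp: A_def)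
  then have "min T (t n + \<tau>) \<le> \<sigma>"
    unfolding \<sigma>_def using bdd by (rule cSup_upper)
  \<comment> \<open>The choice of \<open>n\<close> gives \<open>t n + \<tau> > \<sigma>\<close>, so
    the minimum, being at most \<sigma>, can only be \<open>T\<close>.\<close>
  then have "T \<le> t n + \<tau>"
    using n(2) by (auto simp: dist_real_def)
  from sol[OF this] show ?thesis by (auto simp: sol_def)
qed

subsection \<open>Error estimates\<close>

text \<open>The vector \<open>f' (z t) (f (z t))\<close> is the second derivative of
  \<open>z\<close>. Two mean value estimates, first for \<open>f (z t)\<close> and then for
  \<open>z\<close>, give the constant \<open>c\<close>; Taylor's formula would give
  \<open>c / 2\<close>.\<close>

lemma ode_solution_euler_error:
  assumes C1: "C1_map f f'" and z: "ode_solution_on f {a..b} z" and "a \<le> b"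
    and c: "\<And>t. t \<in> {a..b} \<Longrightarrow> norm (f' (z t) (f (z t))) \<le> c"
  shows "norm (z b - z a - (b - a) *\<^sub>R f (z a)) \<le> c * (b - a)\<^sup>2"
proof -
  have "c \<ge> 0" using c[of a] \<open>a \<le> b\<close> by (meson atLeastAtMost_iff norm_ge_zero order_refl order_trans)
  have dz: "(z has_vector_derivative f (z t)) (at t within {a..b})" if "t \<in> {a..b}" for t
    using z that by (simp add: ode_solution_on_def)
  have "norm (f (z t) - f (z a)) \<le> c * (b - a)" if t: "t \<in> {a..b}" for t
  proof -
    have "norm (f (z t) - f (z a)) \<le> c * norm (t - a)"
      by (rule vector_derivative_bound[OF _ C1_map_has_vector_derivative_compose[OF C1 dz] c])
         (use t \<open>a \<le> b\<close> in auto)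
    also have "\<dots> \<le> c * (b - a)"
      using t \<open>c \<ge> 0\<close> by (intro mult_left_mono) auto
    finally show ?thesis .
  qed
  then have "norm (z b - z a - (b - a) *\<^sub>R f (z a)) \<le> norm (b - a) * (c * (b - a))"
    using \<open>a \<le> b\<close>
    by (intro vector_differentiable_bound_linearization[OF dz]) (auto simp: closed_segment_eq_real_ivl)
  then show ?thesis
    using \<open>a \<le> b\<close> by (simp add: power2_eq_square mult_ac)
qed

text \<open>Here the factor 1/2 is wanted, since it enters the constant
  \<open>1 + c * \<beta> / 2\<close>. It comes from comparing with a quadratic majorant along the
  segment instead of a constant bound on the derivative.\<close>

lemma C1_map_second_order_error:
  assumes \<Phi>: "C1_map \<Phi> D" and D: "C1_map D D2"
    and \<beta>: "\<And>q. q \<in> closed_segment \<theta> (\<theta> + v) \<Longrightarrow> norm (D2 q) \<le> \<beta>"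
  shows "norm (\<Phi> (\<theta> + v) - \<Phi> \<theta> - D \<theta> v) \<le> \<beta> / 2 * (norm v)\<^sup>2"
proof -
  \<comment> \<open>Subtracting the linear part makes \<open>g 1 - g 0\<close> the Taylor remainder,
    while \<open>g'\<close> is a difference of values of \<open>D\<close> and thus at most
    \<open>\<beta> * (norm v)\<^sup>2 * s\<close>, the derivative of \<phi>.\<close>
  define g where "g = (\<lambda>s. \<Phi> (\<theta> + s *\<^sub>R v) - s *\<^sub>R D \<theta> v)"
  define \<phi> where "\<phi> = (\<lambda>s. \<beta> / 2 * (norm v)\<^sup>2 * s\<^sup>2)"
  have line: "((\<lambda>s. \<theta> + s *\<^sub>R v) has_vector_derivative v) (at s)" for s
    by (auto intro!: derivative_eq_intros)
  have dg: "(g has_vector_derivative D (\<theta> + s *\<^sub>R v) v - D \<theta> v) (at s)" for s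
    unfolding g_def
    by (rule has_vector_derivative_diff[OF C1_map_has_vector_derivative_compose[OF \<Phi> line]])
       (auto intro!: derivative_eq_intros)
  have d\<phi>: "(\<phi> has_vector_derivative \<beta> * (norm v)\<^sup>2 * s) (at s)" for s
    unfolding \<phi>_def has_real_derivative_iff_has_vector_derivative[symmetric]
    by (auto intro!: derivative_eq_intros)
  have seg: "\<theta> + s *\<^sub>R v \<in> closed_segment \<theta> (\<theta> + v)" if "0 \<le> s" "s \<le> 1" for s
    using that by (auto simp: closed_segment_def algebra_simps)
  have "norm (g 1 - g 0) \<le> \<phi> 1 - \<phi> 0"
  proof (rule differentiable_bound_general)
    show "continuous_on {0..1} g" "continuous_on {0..1} \<phi>"
      using dg d\<phi> by (auto intro!: continuous_at_imp_continuous_on has_vector_derivative_continuous)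
    show "norm (D (\<theta> + s *\<^sub>R v) v - D \<theta> v) \<le> \<beta> * (norm v)\<^sup>2 * s" if s: "0 < s" "s < 1" for s
    proof -
      have "norm (D (\<theta> + s *\<^sub>R v) - D \<theta>) \<le> \<beta> * norm (\<theta> + s *\<^sub>R v - \<theta>)"
      proof (rule differentiable_bound)
        show "(D has_derivative D2 q) (at q within closed_segment \<theta> (\<theta> + v))" for q
          using D by (auto simp: C1_map_def intro: has_derivative_at_withinI)
        show "onorm (D2 q) \<le> \<beta>" if "q \<in> closed_segment \<theta> (\<theta> + v)" for q
          using \<beta>[OF that] by (simp add: norm_blinfun.rep_eq)
      qed (use seg s in auto)
      then have "norm (D (\<theta> + s *\<^sub>R v) - D \<theta>) * norm v \<le> \<beta> * (s * norm v) * norm v"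
        using s by (intro mult_right_mono) auto
      moreover have "norm (D (\<theta> + s *\<^sub>R v) v - D \<theta> v) \<le> norm (D (\<theta> + s *\<^sub>R v) - D \<theta>) * norm v"
        using norm_blinfun[of "D (\<theta> + s *\<^sub>R v) - D \<theta>" v] by (simp add: blinfun.diff_left)
      ultimately show ?thesis by (simp add: power2_eq_square mult_ac)
    qed
  qed (use dg d\<phi> in auto)
  then show ?thesis by (simp add: g_def \<phi>_def algebra_simps)
qed

section \<open>Accumulation of the errors\<close>

text \<open>The error of step \<open>j\<close> appears at time \<open>(j + 1) * h\<close> and is
  amplified over the remaining \<open>n - 1 - j\<close> steps, hence the \<open>n - 1\<close> in the
  exponent. The subtraction is one of reals; for \<open>n = 0\<close> the sum is empty.\<close>

lemma discrete_gronwall: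
  fixes e g :: "nat \<Rightarrow> real"
  assumes "e 0 = 0" and step: "\<And>n. n < N \<Longrightarrow> e (Suc n) \<le> exp (l * h) * e n + h * g n"
    and "n \<le> N"
  shows "e n \<le> h * (\<Sum>j=0..<n. exp (l * ((real n - 1) * h - real j * h)) * g j)"
  using \<open>n \<le> N\<close>
proof (induction n)
  case 0
  then show ?case using \<open>e 0 = 0\<close> by simp
next
  case (Suc n)
  \<comment> \<open>One more step shifts every old exponent by \<open>l * h\<close>; the new summand
    \<open>j = n\<close> has exponent 0.\<close>
  have exp_Suc: "exp (l * h) * exp (l * ((real n - 1) * h - real j * h)) =
      exp (l * ((real (Suc n) - 1) * h - real j * h))" for j
    by (simp add: algebra_simps flip: exp_add)
  have "e (Suc n) \<le> exp (l * h) * e n + h * g n"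
    using Suc.prems by (intro step) simp
  also have "\<dots> \<le> exp (l * h) *
      (h * (\<Sum>j=0..<n. exp (l * ((real n - 1) * h - real j * h)) * g j)) + h * g n"
    using Suc by (intro add_right_mono mult_left_mono) auto
  also have "\<dots> = h * ((\<Sum>j=0..<n. exp (l * h) * exp (l * ((real n - 1) * h - real j * h)) * g j) + g n)"
    by (simp add: sum_distrib_left algebra_simps)
  also have "\<dots> = h * (\<Sum>j=0..<Suc n. exp (l * ((real (Suc n) - 1) * h - real j * h)) * g j)"
    by (simp only: exp_Suc) simp
  finally show ?case .
qed

lemma regularized_euler_local_error:
  fixes f :: "'h::real_normed_vector \<Rightarrow> 'h" and \<Phi> :: "'q::real_normed_vector \<Rightarrow> 'h"
  assumes \<Phi>: "C1_map \<Phi> D" and D: "C1_map D D2" and f: "C1_map f f'"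
    and "h > 0" "\<epsilon> n > 0"
    and step: "\<theta> (Suc n) = \<theta> n + h *\<^sub>R d\<theta> n"
    and restr: "h * defect f \<Phi> D \<epsilon> \<theta> d\<theta> n \<le> c * (\<epsilon> n)\<^sup>2"
    and \<beta>: "\<And>q. q \<in> closed_segment (\<theta> n) (\<theta> (Suc n)) \<Longrightarrow> norm (D2 q) \<le> \<beta>"
    and z: "ode_solution_on f {a..a + h} z" "z a = \<Phi> (\<theta> n)"
    and c2: "\<And>t. t \<in> {a..a + h} \<Longrightarrow> norm (f' (z t) (f (z t))) \<le> c\<^sub>2"
  shows "norm (\<Phi> (\<theta> (Suc n)) - z (a + h))
    \<le> h * ((1 + c * \<beta> / 2) * defect f \<Phi> D \<epsilon> \<theta> d\<theta> n + c\<^sub>2 * h)"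
proof -
  define \<delta> where "\<delta> = defect f \<Phi> D \<epsilon> \<theta> d\<theta> n"
  have \<delta>: "\<delta> \<ge> 0" "\<delta>\<^sup>2 = (norm (D (\<theta> n) (d\<theta> n) - f (\<Phi> (\<theta> n))))\<^sup>2 + (\<epsilon> n)\<^sup>2 * (norm (d\<theta> n))\<^sup>2"
    by (simp_all add: \<delta>_def defect_def reg_objective_def)
  have residual: "norm (D (\<theta> n) (d\<theta> n) - f (\<Phi> (\<theta> n))) \<le> \<delta>"
    by (rule power2_le_imp_le) (simp_all add: \<delta>)
  have "norm (D2 (\<theta> n)) \<le> \<beta>" by (rule \<beta>) simp
  then have "\<beta> \<ge> 0" by (rule order_trans[OF norm_ge_zero])
  have velocity: "h * (norm (d\<theta> n))\<^sup>2 \<le> c * \<delta>"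
  proof -
    have "(\<epsilon> n)\<^sup>2 * (h * (norm (d\<theta> n))\<^sup>2) = h * ((\<epsilon> n)\<^sup>2 * (norm (d\<theta> n))\<^sup>2)"
      by simp
    also have "\<dots> \<le> h * \<delta>\<^sup>2"
      using \<open>h > 0\<close> by (intro mult_left_mono) (simp_all add: \<delta>)
    also have "\<dots> = h * \<delta> * \<delta>" by (simp add: power2_eq_square)
    also have "\<dots> \<le> c * (\<epsilon> n)\<^sup>2 * \<delta>"
      using restr \<delta>(1) by (intro mult_right_mono) (simp_all add: \<delta>_def)
    finally have "(\<epsilon> n)\<^sup>2 * (h * (norm (d\<theta> n))\<^sup>2) \<le> (\<epsilon> n)\<^sup>2 * (c * \<delta>)"
      by (simp add: mult_ac)
    then show ?thesis
      using \<open>\<epsilon> n > 0\<close> by (simp add: mult_le_cancel_left)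
  qed
  have "norm (\<Phi> (\<theta> (Suc n)) - \<Phi> (\<theta> n) - D (\<theta> n) (h *\<^sub>R d\<theta> n)) \<le> \<beta> / 2 * (norm (h *\<^sub>R d\<theta> n))\<^sup>2"
    unfolding step by (rule C1_map_second_order_error[OF \<Phi> D]) (use \<beta> in \<open>simp add: step\<close>)
  also have "\<dots> = h * (\<beta> / 2) * (h * (norm (d\<theta> n))\<^sup>2)"
    using \<open>h > 0\<close> by (simp add: power_mult_distrib power2_eq_square)
  also have "\<dots> \<le> h * (\<beta> / 2) * (c * \<delta>)"
    using \<open>h > 0\<close> \<open>\<beta> \<ge> 0\<close> by (intro mult_left_mono velocity) simp
  finally have 1: "norm (\<Phi> (\<theta> (Suc n)) - \<Phi> (\<theta> n) - D (\<theta> n) (h *\<^sub>R d\<theta> n)) \<le> h * (\<beta> / 2) * (c * \<delta>)" .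
  have 2: "norm (h *\<^sub>R (D (\<theta> n) (d\<theta> n) - f (\<Phi> (\<theta> n)))) \<le> h * \<delta>"
    using \<open>h > 0\<close> residual by simp
  have 3: "norm (z (a + h) - z a - (a + h - a) *\<^sub>R f (z a)) \<le> c\<^sub>2 * (a + h - a)\<^sup>2"
    using \<open>h > 0\<close> by (intro ode_solution_euler_error[OF f z(1) _ c2]) auto
  \<comment> \<open>Curvature of \<Phi>, residual of the minimization, and Euler error of the exact
    flow; the rest cancels because \<open>z a = \<Phi> (\<theta> n)\<close>.\<close>
  have "\<Phi> (\<theta> (Suc n)) - z (a + h) =
      (\<Phi> (\<theta> (Suc n)) - \<Phi> (\<theta> n) - D (\<theta> n) (h *\<^sub>R d\<theta> n))
      + h *\<^sub>R (D (\<theta> n) (d\<theta> n) - f (\<Phi> (\<theta> n)))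
      - (z (a + h) - z a - (a + h - a) *\<^sub>R f (z a))"
    by (simp add: z(2) blinfun.scaleR_right scaleR_diff_right)
  also have "norm \<dots> \<le> h * (\<beta> / 2) * (c * \<delta>) + h * \<delta> + c\<^sub>2 * (a + h - a)\<^sup>2"
    by (intro norm_triangle_le_diff norm_triangle_le add_mono 1 2 3)
  also have "\<dots> = h * ((1 + c * \<beta> / 2) * \<delta> + c\<^sub>2 * h)"
    by (simp add: power2_eq_square algebra_simps)
  finally show ?thesis by (simp only: \<delta>_def)
qed

lemma regularized_euler_error:
  fixes f :: "'h::{real_inner,complete_space} \<Rightarrow> 'h" and \<Phi> :: "'q::real_normed_vector \<Rightarrow> 'h"
  assumes \<Phi>: "C1_map \<Phi> D" and D: "C1_map D D2" and f: "C1_map f f'"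
    and osl: "\<And>v w. inner (v - w) (f v - f w) \<le> l * (norm (v - w))\<^sup>2"
    and y: "ode_solution_on f {0..tbar} y" and "h > 0" "real N * h \<le> tbar"
    and \<epsilon>: "\<forall>n\<le>N. \<epsilon> n > 0"
    and euler: "regularized_euler f \<Phi> D h N \<epsilon> \<theta> d\<theta>" and "\<Phi> (\<theta> 0) = y 0"
    and restr: "\<forall>n\<le>N. h * defect f \<Phi> D \<epsilon> \<theta> d\<theta> n \<le> c * (\<epsilon> n)\<^sup>2"
    and \<beta>: "second_derivative_bound_on_steps D2 N \<theta> \<beta>"
    and c2: "local_solution_bound f f' h N (\<lambda>n. \<Phi> (\<theta> n)) c\<^sub>2"
    and "n \<le> N"
  shows "norm (\<Phi> (\<theta> n) - y (real n * h))
    \<le> h * (\<Sum>j=0..<n. exp (l * ((real n - 1) * h - real j * h)) *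
          ((1 + c * \<beta> / 2) * defect f \<Phi> D \<epsilon> \<theta> d\<theta> j + c\<^sub>2 * h))"
proof (rule discrete_gronwall[where e = "\<lambda>n. norm (\<Phi> (\<theta> n) - y (real n * h))"])
  fix n assume n: "n < N"
  define a where "a = real n * h"
  have Suc: "real (Suc n) * h = a + h" by (simp add: a_def algebra_simps)
  have "a \<ge> 0" using \<open>h > 0\<close> by (simp add: a_def)
  have "real (Suc n) * h \<le> real N * h"
    using n \<open>h > 0\<close> by (intro mult_right_mono) auto
  then have "a + h \<le> tbar" using Suc \<open>real N * h \<le> tbar\<close> by simp
  \<comment> \<open>The hypothesis \<open>local_solution_bound\<close> speaks about all restarted
    solutions and would be vacuous without one. The equation is autonomous, so a solution from time
    0 can be shifted to start at \<open>a\<close>.\<close>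
  obtain z0 where z0: "z0 0 = \<Phi> (\<theta> n)" "ode_solution_on f {0..h} z0"
    using ode_solution_exists[OF osl f, of h] \<open>h > 0\<close> by (metis less_imp_le)
  define z where "z = (\<lambda>t. z0 (t - a))"
  have z: "z a = \<Phi> (\<theta> n)" "ode_solution_on f {a..a + h} z"
    using z0(1) ode_solution_on_shift[OF z0(2), of a] by (simp_all add: z_def add.commute)
  have "norm (\<Phi> (\<theta> (Suc n)) - z (a + h))
      \<le> h * ((1 + c * \<beta> / 2) * defect f \<Phi> D \<epsilon> \<theta> d\<theta> n + c\<^sub>2 * h)"
  proof (rule regularized_euler_local_error[where \<theta> = \<theta> and n = n and \<epsilon> = \<epsilon>,
        OF \<Phi> D f \<open>h > 0\<close> _ _ _ _ z(2,1)])
    show "\<theta> (Suc n) = \<theta> n + h *\<^sub>R d\<theta> n"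
      using euler n by (simp add: regularized_euler_def)
    show "norm (D2 q) \<le> \<beta>" if "q \<in> closed_segment (\<theta> n) (\<theta> (Suc n))" for q
      using \<beta> n that by (auto simp: second_derivative_bound_on_steps_def)
    show "norm (f' (z t) (f (z t))) \<le> c\<^sub>2" if "t \<in> {a..a + h}" for t
      using c2[unfolded local_solution_bound_def, rule_format, OF n, of z t] z that
      unfolding Suc a_def[symmetric] by blast
  qed (use n \<epsilon> restr in auto)
  moreover have "norm (z (a + h) - y (a + h)) \<le> exp (l * (a + h - a)) * norm (z a - y a)"
    using \<open>a \<ge> 0\<close> \<open>h > 0\<close> \<open>a + h \<le> tbar\<close>
    by (intro ode_solutions_norm_diff_le[OF osl z(2) ode_solution_on_subset[OF y]]) auto
  moreover have "norm (\<Phi> (\<theta> (Suc n)) - y (a + h))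
      \<le> norm (\<Phi> (\<theta> (Suc n)) - z (a + h)) + norm (z (a + h) - y (a + h))"
    using norm_triangle_ineq[of "\<Phi> (\<theta> (Suc n)) - z (a + h)" "z (a + h) - y (a + h)"] by simp
  ultimately show "norm (\<Phi> (\<theta> (Suc n)) - y (real (Suc n) * h))
      \<le> exp (l * h) * norm (\<Phi> (\<theta> n) - y (real n * h))
        + h * ((1 + c * \<beta> / 2) * defect f \<Phi> D \<epsilon> \<theta> d\<theta> n + c\<^sub>2 * h)"
    unfolding Suc a_def[symmetric] z(1) by simp
qed (use assms in auto)

text \<open>Each exponential is at most \<open>exp (\<bar>l\<bar> * T)\<close>, whatever the sign of
  \<open>l\<close>, and \<open>n\<close> equal terms times \<open>h\<close> contribute at most
  \<open>T\<close>. The constant is therefore independent of \<open>h\<close>, \<open>n\<close> and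
  the defects.\<close>

lemma exp_weighted_sum_le:
  fixes \<delta> :: "nat \<Rightarrow> real"
  assumes "h > 0" "real N * h \<le> T" "n \<le> N" and \<delta>: "\<And>j. j < n \<Longrightarrow> 0 \<le> \<delta> j \<and> \<delta> j \<le> m" and "0 \<le> m"
  shows "h * (\<Sum>j=0..<n. exp (l * ((real n - 1) * h - real j * h)) * (c\<^sub>1 * \<delta> j + c\<^sub>2 * h))
    \<le> T * exp (\<bar>l\<bar> * T) * (\<bar>c\<^sub>1\<bar> + \<bar>c\<^sub>2\<bar>) * (m + h)"
proof -
  have nh: "real n * h \<le> T"
    by (rule order_trans[OF mult_right_mono \<open>real N * h \<le> T\<close>]) (use assms in auto)
  have "exp (l * ((real n - 1) * h - real j * h)) * (c\<^sub>1 * \<delta> j + c\<^sub>2 * h)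
      \<le> exp (\<bar>l\<bar> * T) * ((\<bar>c\<^sub>1\<bar> + \<bar>c\<^sub>2\<bar>) * (m + h))" if "j < n" for j
  proof (rule order_trans[OF mult_left_mono mult_right_mono])
    \<comment> \<open>The truncated subtraction on the right is exact because \<open>j < n\<close>;
      it shows that the elapsed time is nonnegative.\<close>
    have eq: "(real n - 1) * h - real j * h = real (n - 1 - j) * h"
      using that by (simp add: of_nat_diff algebra_simps)
    have "real (n - 1 - j) * h \<le> real n * h"
      using \<open>h > 0\<close> by (intro mult_right_mono) auto
    then have "real (n - 1 - j) * h \<le> T"
      using nh by (rule order_trans)
    then have "0 \<le> (real n - 1) * h - real j * h" "(real n - 1) * h - real j * h \<le> T"
      unfolding eq using \<open>h > 0\<close> by simp_all
    then have "l * ((real n - 1) * h - real j * h) \<le> \<bar>l\<bar> * T"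
      by (intro mult_mono) auto
    then show "exp (l * ((real n - 1) * h - real j * h)) \<le> exp (\<bar>l\<bar> * T)" by simp
    have "c\<^sub>1 * \<delta> j \<le> \<bar>c\<^sub>1\<bar> * m" "c\<^sub>2 * h \<le> \<bar>c\<^sub>2\<bar> * h"
      using \<delta>[OF that] \<open>h > 0\<close> by (auto intro!: mult_mono)
    moreover have "0 \<le> \<bar>c\<^sub>1\<bar> * h" "0 \<le> \<bar>c\<^sub>2\<bar> * m" using \<open>h > 0\<close> \<open>0 \<le> m\<close> by auto
    ultimately show "c\<^sub>1 * \<delta> j + c\<^sub>2 * h \<le> (\<bar>c\<^sub>1\<bar> + \<bar>c\<^sub>2\<bar>) * (m + h)"
      by (simp add: algebra_simps)
  qed (use \<open>h > 0\<close> \<open>0 \<le> m\<close> in auto)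
  then have "(\<Sum>j=0..<n. exp (l * ((real n - 1) * h - real j * h)) * (c\<^sub>1 * \<delta> j + c\<^sub>2 * h))
      \<le> real n * (exp (\<bar>l\<bar> * T) * ((\<bar>c\<^sub>1\<bar> + \<bar>c\<^sub>2\<bar>) * (m + h)))"
    by (intro order_trans[OF sum_bounded_above[where
          K = "exp (\<bar>l\<bar> * T) * ((\<bar>c\<^sub>1\<bar> + \<bar>c\<^sub>2\<bar>) * (m + h))"]]) auto
  then have "h * (\<Sum>j=0..<n. exp (l * ((real n - 1) * h - real j * h)) * (c\<^sub>1 * \<delta> j + c\<^sub>2 * h))
      \<le> h * (real n * (exp (\<bar>l\<bar> * T) * ((\<bar>c\<^sub>1\<bar> + \<bar>c\<^sub>2\<bar>) * (m + h))))"
    using \<open>h > 0\<close> by (intro mult_left_mono) auto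
  also have "\<dots> = real n * h * (exp (\<bar>l\<bar> * T) * ((\<bar>c\<^sub>1\<bar> + \<bar>c\<^sub>2\<bar>) * (m + h)))"
    by (simp add: mult_ac)
  also have "\<dots> \<le> T * (exp (\<bar>l\<bar> * T) * ((\<bar>c\<^sub>1\<bar> + \<bar>c\<^sub>2\<bar>) * (m + h)))"
    using nh \<open>h > 0\<close> \<open>0 \<le> m\<close> by (intro mult_right_mono) auto
  finally show ?thesis by (simp add: mult_ac)
qed

text \<open>Polarization: both sides are real bilinear forms inducing the same norm, and the square
  of \<open>norm (x + y)\<close> determines the mixed term.\<close>

lemma Re_hilbert_inner_product:
  assumes "hilbert_inner_product ip"
  shows "Re (ip x y) = inner x y"
proof -
  consider "ip = (\<lambda>x y. of_real (inner x y))" | sc where "complex_inner_product sc ip"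
    using assms by (auto simp: hilbert_inner_product_def)
  then show ?thesis
  proof cases
    case 2
    then have add: "ip a (b + c) = ip a b + ip a c" and sym: "ip b a = cnj (ip a b)"
      and self: "ip a a = of_real ((norm a)\<^sup>2)" for a b c
      unfolding complex_inner_product_def by blast+
    have addl: "ip (a + b) c = ip a c + ip b c" for a b c
      by (simp only: sym[of _ c] add complex_cnj_add)
    have "Re (ip y x) = Re (ip x y)"
      using sym[of x y] by simp
    then have "Re (ip (x + y) (x + y)) = Re (ip x x) + 2 * Re (ip x y) + Re (ip y y)"
      by (simp add: add addl)
    then have "(norm (x + y))\<^sup>2 = (norm x)\<^sup>2 + 2 * Re (ip x y) + (norm y)\<^sup>2"
      by (simp only: self Re_complex_of_real)
    then show ?thesis
      by (simp add: dot_norm)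
  qed simp
qed

theorem theorem4p1:
  fixes ip :: "'h::{real_inner,complete_space} \<Rightarrow> 'h \<Rightarrow> complex"
    and f :: "'h \<Rightarrow> 'h" and f' :: "'h \<Rightarrow> 'h \<Rightarrow>\<^sub>L 'h"
    and \<Phi> :: "'q::real_inner \<Rightarrow> 'h" and D :: "'q \<Rightarrow> 'q \<Rightarrow>\<^sub>L 'h" and D2 :: "'q \<Rightarrow> 'q \<Rightarrow>\<^sub>L 'q \<Rightarrow>\<^sub>L 'h"
    and y :: "real \<Rightarrow> 'h" and tbar l c \<beta> c\<^sub>2 :: real
  assumes "hilbert_inner_product ip"
    and "finite_dimensional TYPE('q)"
    and "C1_map \<Phi> D" and "C1_map D D2" and "bounded (range D2)"
    and "C1_map f f'"
    and "\<And>v w. Re (ip (v - w) (f v - f w)) \<le> l * (norm (v - w))\<^sup>2"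
    and "ode_solution_on f {0..tbar} y"
    and "c > 0"
  shows "\<exists>C. \<forall>h N \<epsilon> \<theta> d\<theta>.
     h > 0 \<longrightarrow> real N * h \<le> tbar \<longrightarrow> (\<forall>n\<le>N. \<epsilon> n > 0) \<longrightarrow>
     regularized_euler f \<Phi> D h N \<epsilon> \<theta> d\<theta> \<longrightarrow> \<Phi> (\<theta> 0) = y 0 \<longrightarrow>
     (\<forall>n\<le>N. h * defect f \<Phi> D \<epsilon> \<theta> d\<theta> n \<le> c * (\<epsilon> n)\<^sup>2) \<longrightarrow>
     second_derivative_bound_on_steps D2 N \<theta> \<beta> \<longrightarrow>
     local_solution_bound f f' h N (\<lambda>n. \<Phi> (\<theta> n)) c\<^sub>2 \<longrightarrow>
     (\<forall>n\<le>N.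
        norm (\<Phi> (\<theta> n) - y (real n * h))
          \<le> C * (Max (defect f \<Phi> D \<epsilon> \<theta> d\<theta> ` {0..N}) + h) \<and>
        norm (\<Phi> (\<theta> n) - y (real n * h))
          \<le> h * (\<Sum>j=0..<n. exp (l * ((real n - 1) * h - real j * h)) *
                  ((1 + c * \<beta> / 2) * defect f \<Phi> D \<epsilon> \<theta> d\<theta> j + c\<^sub>2 * h)))"
proof (intro exI allI impI conjI)
  fix h N \<epsilon> \<theta> d\<theta> n
  assume hyps: "h > 0" "real N * h \<le> tbar" "\<forall>n\<le>N. \<epsilon> n > 0"
    "regularized_euler f \<Phi> D h N \<epsilon> \<theta> d\<theta>" "\<Phi> (\<theta> 0) = y 0"
    "\<forall>n\<le>N. h * defect f \<Phi> D \<epsilon> \<theta> d\<theta> n \<le> c * (\<epsilon> n)\<^sup>2"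
    "second_derivative_bound_on_steps D2 N \<theta> \<beta>"
    "local_solution_bound f f' h N (\<lambda>n. \<Phi> (\<theta> n)) c\<^sub>2" and n: "n \<le> N"
  have osl: "inner (v - w) (f v - f w) \<le> l * (norm (v - w))\<^sup>2" for v w
    using assms(7) by (simp add: Re_hilbert_inner_product[OF assms(1)])
  show precise: "norm (\<Phi> (\<theta> n) - y (real n * h))
      \<le> h * (\<Sum>j=0..<n. exp (l * ((real n - 1) * h - real j * h)) *
            ((1 + c * \<beta> / 2) * defect f \<Phi> D \<epsilon> \<theta> d\<theta> j + c\<^sub>2 * h))"
    using assms(8) hyps n
    by (rule regularized_euler_error[OF assms(3,4,6) osl])
  let ?\<delta> = "defect f \<Phi> D \<epsilon> \<theta> d\<theta>"
  have \<delta>: "0 \<le> ?\<delta> j \<and> ?\<delta> j \<le> Max (?\<delta> ` {0..N})" if "j \<le> N" for j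
    using that by (auto simp: defect_def reg_objective_def)
  note precise
  \<comment> \<open>This fixes the witness \<open>C\<close>, built only from \<open>tbar\<close>,
    \<open>l\<close>, \<open>c\<close>, \<beta> and \<open>c\<^sub>2\<close>, hence the same for all
    step sizes, regularization parameters and numerical trajectories.\<close>
  also have "h * (\<Sum>j=0..<n. exp (l * ((real n - 1) * h - real j * h)) *
            ((1 + c * \<beta> / 2) * ?\<delta> j + c\<^sub>2 * h))
      \<le> tbar * exp (\<bar>l\<bar> * tbar) * (\<bar>1 + c * \<beta> / 2\<bar> + \<bar>c\<^sub>2\<bar>) * (Max (?\<delta> ` {0..N}) + h)"
    using n order_trans[OF _ conjunct2[OF \<delta>[of 0]]] conjunct1[OF \<delta>[of 0]]
    by (intro exp_weighted_sum_le[OF hyps(1,2) n] \<delta>) auto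
  finally show "norm (\<Phi> (\<theta> n) - y (real n * h))
      \<le> tbar * exp (\<bar>l\<bar> * tbar) * (\<bar>1 + c * \<beta> / 2\<bar> + \<bar>c\<^sub>2\<bar>) * (Max (?\<delta> ` {0..N}) + h)" .
qed

end
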